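(* Let $k\ge 1$ and $n\ge 1$ be integers and suppose $U^{k}(\mathbb{Z}_{n})$ is a boolean ring. Then for all (positive) divisors $m$ of $n$, either $U^{k}(\mathbb{Z}_{m})\approx\{0\}$ or $U^{k}(\mathbb{Z}_{m})$ is a boolean ring.
   Context: For an integer $n\ge 1$, $\mathbb{Z}_n$ is the ring of integers modulo $n$ ($\mathbb{Z}_1=\{0\}$). For a finite commutative ring $R$ with identity (the zero ring is allowed, with $U(\{0\})=\{0\}$), $U(R)$ is its group of units. Since $U(R)$ is a finite abelian group, it is isomorphic to a product $\mathbb{Z}_{n_1}\times\cdots\times\mathbb{Z}_{n_i}$ of cyclic groups, and $U(R)$ is regarded as a ring by transporting the ring structure of $\mathbb{Z}_{n_1}\oplus\cdots\oplus\mathbb{Z}_{n_i}$ (up to ring isomorphism this does not depend on the chosen decomposition). The $k$-th (generalized) group of units is defined by $U^0(R)=R$, $U^1(R)=U(R)$ and $U^k(R)=U(U^{k-1}(R))$, where $U^{k-1}(R)$ is viewed as a ring in this way. The symbol $\approx$ denotes isomorphism (as groups, equivalently as rings with these structures). $\{0\}$ is the trivial group (ring). "Boolean ring" means a nontrivial ring in which $x^2=x$ for all $x$ (in the finite case: isomorphic to a direct sum of $r\ge 1$ copies of $\mathbb{Z}_2$). *)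

theory Defs
  imports "HOL-Algebra.Algebra"
begin

abbreviation Zn_ring :: "nat \<Rightarrow> int set ring"
  where "Zn_ring n \<equiv> ZFact (int n)"

definition Zn_ring_sum :: "nat list \<Rightarrow> int set list ring"
  where "Zn_ring_sum ns = RDirProd_list (map Zn_ring ns)"

definition cyclic_decomposition ::
    "('a, 'b) monoid_scheme \<Rightarrow> nat list \<times> (int set list \<Rightarrow> 'a) \<Rightarrow> bool"
  where "cyclic_decomposition G = (\<lambda>(ns, f).
    (\<forall>m\<in>set ns. m \<ge> 1) \<and> f \<in> iso (add_monoid (Zn_ring_sum ns)) G)"

(* The ring has carrier Units R. Its addition is the multiplication of R (so its zero is the one
   of R), and its multiplication is transported from the direct sum of the Z_m along a chosen
   decomposition. A decomposition exists whenever R is a finite commutative ring, and another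
   choice gives an isomorphic ring. *)
definition units_ring :: "'a ring \<Rightarrow> 'a ring"
  where "units_ring R =
    (let (ns, f) = (SOME d. cyclic_decomposition (units_of R) d) in image_ring f (Zn_ring_sum ns))"

primrec gen_units :: "nat \<Rightarrow> 'a ring \<Rightarrow> 'a ring"
  where
    "gen_units 0 R = R"
  | "gen_units (Suc k) R = units_ring (gen_units k R)"

definition boolean_ring :: "('a, 'b) ring_scheme \<Rightarrow> bool"
  where "boolean_ring R \<longleftrightarrow>
    ring R \<and> carrier R \<noteq> {\<zero>\<^bsub>R\<^esub>} \<and> (\<forall>x\<in>carrier R. x \<otimes>\<^bsub>R\<^esub> x = x)"

end

theory Submission
  imports Defs "HOL-Number_Theory.Cong"
begin

text \<open>
The iterated unit groups of \<open>\<int>/m\<close> are controlled by those of \<open>\<int>/n\<close> for \<open>m dvd n\<close>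
because the passage from a finite direct sum of rings \<open>\<int>/n\<^sub>i\<close> to its group of units
is monotone in a numerical sense. To a list \<open>ns\<close> of moduli belong the numbers
\<open>prime_power_rank q f ns\<close>, the number of entries divisible by the prime power \<open>q\<^sup>f\<close>. They
determine the ring up to isomorphism (by the Chinese remainder theorem), and they can be read
off the additive group: the factor by which the number of solutions of \<open>p\<^sup>e x = 0\<close> grows when
\<open>e\<close> is replaced by \<open>e + 1\<close> is \<open>p\<close> to the power \<open>prime_power_rank p (e + 1) ns\<close>
(lemma \<open>torsion_growth_add_Zn_sum\<close>). In particular the numbers do not depend on the
decomposition by which the unit group was made into a ring, so that the arbitrary choice in that
construction causes no difficulty.

The inductive claim (lemma \<open>gen_units_prime_power_rank_le\<close>) is that the ranks for \<open>m\<close> never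
exceed those for \<open>n\<close>. For the step, let \<open>L(n)\<close> be the growth of the \<open>p\<close>-power torsion,
at a fixed exponent, in the unit group of \<open>\<int>/n\<close>. The growth in the unit group of a direct sum
is the product of the \<open>L(n\<^sub>i)\<close>, and \<open>L\<close> is multiplicative on coprime arguments. Hence this
product equals the product over all prime powers \<open>q\<^sup>f\<close> of
\<open>L(q\<^sup>f) / L(q\<^sup>f\<^sup>-\<^sup>1)\<close> raised to the power \<open>prime_power_rank q f ns\<close>. As
reduction maps the units modulo \<open>q\<^sup>f\<close> onto the units modulo \<open>q\<^sup>f\<^sup>-\<^sup>1\<close> and torsion growth
cannot increase under a surjective homomorphism of finite abelian groups (lemma
\<open>torsion_growth_epi\<close>), all these quotients are at least 1. So larger ranks give larger torsion
growth in the units, that is, larger ranks at the next stage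
(lemma \<open>prod_list_mono_prime_power_rank\<close>).

A boolean ring satisfies \<open>x + x = 0\<close>, which forces all moduli of a decomposition to divide 2.
Domination of ranks transfers this to the moduli belonging to \<open>m\<close>, and a direct sum of copies
of \<open>\<int>/1\<close> and \<open>\<int>/2\<close> is either trivial or boolean. That a decomposition exists at
every stage is the structure theorem for finite abelian groups
(lemma \<open>finite_comm_group_cyclic_decomposition\<close>).
\<close>

section \<open>Cyclic direct factors of finite abelian groups\<close>

lemma (in comm_group) ord_mult_coprime:
  assumes x: "x \<in> carrier G" and y: "y \<in> carrier G" and cop: "coprime (ord x) (ord y)"
  shows "ord (x \<otimes> y) = ord x * ord y"
proof (rule dvd_antisym)
  show "ord (x \<otimes> y) dvd ord x * ord y"
    using x y by (rule abelian_ord_mul_divides)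
  have dvd: "ord u dvd ord (u \<otimes> v)"
    if u: "u \<in> carrier G" and v: "v \<in> carrier G" and uv: "coprime (ord u) (ord v)" for u v
  proof -
    let ?k = "ord (u \<otimes> v) * ord v"
    have "(u \<otimes> v) [^] ?k = \<one>"
      using u v by (simp add: pow_eq_id)
    moreover have "v [^] ?k = \<one>"
      using v by (simp add: pow_eq_id)
    ultimately have "u [^] ?k = \<one>"
      using u v by (simp add: pow_mult_distrib m_comm)
    hence "ord u dvd ord (u \<otimes> v) * ord v"
      using u by (simp add: pow_eq_id)
    with uv show ?thesis
      by (simp add: coprime_dvd_mult_left_iff)
  qed
  show "ord x * ord y dvd ord (x \<otimes> y)"
    using dvd[OF x y cop] dvd[OF y x] cop x y
    by (simp add: divides_mult coprime_commute m_comm)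
qed

text \<open>If the order of some element failed to divide a maximal order, at a prime \<open>p\<close>, then the
\<open>p\<close>-part of that element times the part of the maximal element prime to \<open>p\<close> would have a
larger order.\<close>

lemma (in comm_group) exists_ord_eq_exponent:
  assumes fin: "finite (carrier G)"
  obtains a where "a \<in> carrier G" "\<And>x. x \<in> carrier G \<Longrightarrow> ord x dvd ord a"
proof -
  have "Max (ord ` carrier G) \<in> ord ` carrier G"
    using fin by (intro Max_in) auto
  then obtain a where a: "a \<in> carrier G" and "ord a = Max (ord ` carrier G)"
    by auto
  hence max: "ord x \<le> ord a" if "x \<in> carrier G" for x
    using that fin by simp
  have pos: "ord x \<noteq> 0" if "x \<in> carrier G" for x
    using ord_ge_1[OF fin that] by simp
  have "ord x dvd ord a" if x: "x \<in> carrier G" for x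
  proof (rule multiplicity_le_imp_dvd)
    show "ord x \<noteq> 0" using pos[OF x] .
    fix p :: nat assume p: "Factorial_Ring.prime p"
    define i j where "i = multiplicity p (ord a)" and "j = multiplicity p (ord x)"
    show "j \<le> i"
    proof (rule ccontr)
      assume "\<not> j \<le> i"
      (* c is the part of the maximal order prime to p; the power of x by e has order p ^ j. *)
      define c where "c = ord a div p ^ i"
      have a_eq: "ord a = p ^ i * c" and pc: "\<not> p dvd c"
        using multiplicity_decompose[of "ord a" p] pos[OF a] prime_gt_1_nat[OF p]
        by (auto simp: c_def i_def multiplicity_dvd)
      define e where "e = ord x div p ^ j"
      have x_eq: "ord x = e * p ^ j"
        by (simp add: e_def j_def multiplicity_dvd)
      have "e \<noteq> 0" using x_eq pos[OF x] by auto
      have oa: "ord (a [^] (p ^ i)) = c"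
        using a p pos[OF a] a_eq by (subst ord_pow) auto
      have ox: "ord (x [^] e) = p ^ j"
        using x pos[OF x] x_eq \<open>e \<noteq> 0\<close> by (subst ord_pow) auto
      have "coprime c (p ^ j)"
        using pc p by (metis coprime_commute coprime_power_left_iff prime_imp_coprime)
      hence "ord (a [^] (p ^ i) \<otimes> x [^] e) = c * p ^ j"
        using a x oa ox by (subst ord_mult_coprime) auto
      with max[of "a [^] (p ^ i) \<otimes> x [^] e"] a x have "c * p ^ j \<le> c * p ^ i"
        by (simp add: a_eq mult.commute)
      moreover have "c > 0" using a_eq pos[OF a] by (cases c) auto
      moreover have "p ^ i < p ^ j"
        using \<open>\<not> j \<le> i\<close> prime_gt_1_nat[OF p] by simp
      ultimately show False by simp
    qed
  qed
  with a that show thesis by blast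
qed

lemma (in group) subset_set_mult:
  assumes "subgroup H G" "subgroup K G"
  shows "H \<subseteq> H <#> K" "K \<subseteq> H <#> K"
proof -
  have "x \<otimes> \<one> \<in> H <#> K" if "x \<in> H" for x
    using that subgroup.one_closed[OF assms(2)] by (auto simp: set_mult_def)
  moreover have "\<one> \<otimes> x \<in> H <#> K" if "x \<in> K" for x
    using that subgroup.one_closed[OF assms(1)] by (auto simp: set_mult_def)
  ultimately show "H \<subseteq> H <#> K" "K \<subseteq> H <#> K"
    using assms by (metis r_one subgroup.mem_carrier subsetI, metis l_one subgroup.mem_carrier subsetI)
qed

text \<open>A subgroup that is maximal among those meeting \<open>\<langle>a\<rangle>\<close> trivially is already a complement. For an
element \<open>x\<close> outside the product of the two, a power of \<open>a\<close> corrects \<open>x\<close> so that the first of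
its powers inside the product lies in the maximal subgroup; adjoining the corrected element would
keep the intersection trivial. The correction exists because the order of \<open>x\<close> divides that of \<open>a\<close>.\<close>

lemma (in comm_group) cyclic_subgroup_complement:
  assumes fin: "finite (carrier G)" and a: "a \<in> carrier G"
    and exponent: "\<And>x. x \<in> carrier G \<Longrightarrow> ord x dvd ord a"
  obtains H where "subgroup H G" "H \<inter> range (\<lambda>i::int. a [^] i) = {\<one>}"
    "H <#> range (\<lambda>i::int. a [^] i) = carrier G"
proof -
  let ?A = "range (\<lambda>i::int. a [^] i)"
  have A: "subgroup ?A G" using a by (rule subgroup_of_powers)
  define \<H> where "\<H> = {H. subgroup H G \<and> H \<inter> ?A = {\<one>}}"
  have "finite \<H>"
    by (rule finite_subset[OF _ finite_Pow_iff[THEN iffD2, OF fin]])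
       (auto simp: \<H>_def dest: subgroup.subset)
  moreover have "{\<one>} \<in> \<H>"
    using subgroup.one_closed[OF A] by (auto simp: \<H>_def triv_subgroup)
  ultimately obtain H where H\<H>: "H \<in> \<H>" and maximal: "\<And>K. K \<in> \<H> \<Longrightarrow> H \<subseteq> K \<Longrightarrow> H = K"
    using finite_has_maximal[of \<H>] by blast
  have H: "subgroup H G" and HA: "H \<inter> ?A = {\<one>}" using H\<H> by (auto simp: \<H>_def)
  define M where "M = H <#> ?A"
  have M: "subgroup M G" unfolding M_def by (rule mult_subgroups[OF H A])
  have HM: "H \<subseteq> M" and AM: "?A \<subseteq> M"
    unfolding M_def by (rule subset_set_mult[OF H A])+
  have "x \<in> M" if x: "x \<in> carrier G" for x
  proof (rule ccontr)
    assume xM: "x \<notin> M"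
    (* d is the order of x modulo M. *)
    define d where "d = (LEAST d::nat. d > 0 \<and> x [^] d \<in> M)"
    have "ord x > 0 \<and> x [^] ord x \<in> M"
      using ord_ge_1[OF fin x] x subgroup.one_closed[OF M] by simp
    hence d: "d > 0" "x [^] d \<in> M" and least: "\<And>k. k > 0 \<Longrightarrow> x [^] k \<in> M \<Longrightarrow> d \<le> k"
      unfolding d_def by (metis (mono_tags, lifting) LeastI, metis (mono_tags, lifting) LeastI, auto intro: Least_le)
    have dvd: "int d dvd k" if k: "x [^] k \<in> M" for k :: int
    proof -
      have "x [^] (k mod int d) = x [^] k \<otimes> inv ((x [^] d) [^] (k div int d))"
        using x by (simp add: int_pow_pow int_pow_diff flip: int_pow_int minus_mult_div_eq_mod)
      also have "\<dots> \<in> M"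
        using k d M by (metis group.int_pow_closed int_pow_consistent group.inv_inv int_pow_neg m_inv_consistent subgroup.m_closed subgroup.m_inv_closed subgroup.mem_carrier subgroup_int_pow_closed)
      finally have "x [^] nat (k mod int d) \<in> M"
        using d by (metis int_pow_int nat_0_le of_nat_0_less_iff pos_mod_sign)
      with least[of "nat (k mod int d)"] d have "\<not> nat (k mod int d) > 0"
        using pos_mod_bound[of "int d" k] by linarith
      moreover have "k mod int d \<ge> 0" using d by simp
      ultimately show ?thesis by (simp add: dvd_eq_mod_eq_0)
    qed
    obtain h j where h: "h \<in> H" and xd: "x [^] d = h \<otimes> a [^] (j::int)"
      using d(2) unfolding M_def set_mult_def by auto
    have hc: "h \<in> carrier G" using h H by (rule subgroup.mem_carrier[rotated])
    have "int d dvd int (ord x)"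
      using dvd[of "int (ord x)"] x subgroup.one_closed[OF M] by (simp add: int_pow_int)
    hence "d dvd ord a" using exponent[OF x] by (meson dvd_trans int_dvd_int_iff)
    then obtain t where t: "ord a = d * t" by blast
    have "t > 0" using t ord_ge_1[OF fin a] by (cases t) auto
    (* The t-th power of x [^] d is trivial because ord a = d * t is the exponent; hence d divides j. *)
    have "\<one> = (x [^] d) [^] t"
      using x exponent[OF x] t by (simp add: nat_pow_pow pow_eq_id[THEN iffD2])
    also have "\<dots> = h [^] t \<otimes> (a [^] j) [^] t"
      unfolding xd using hc a by (simp add: pow_mult_distrib m_comm)
    also have "(a [^] j) [^] t = a [^] (j * int t)"
      using a by (metis int_pow_pow int_pow_int)
    finally have "a [^] (j * int t) = inv (h [^] t)"
      using hc a by (metis inv_equality int_pow_closed inv_inv nat_pow_closed)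
    moreover have "inv (h [^] t) \<in> H"
      using h H by (metis int_pow_int subgroup.m_inv_closed subgroup_int_pow_closed)
    ultimately have "a [^] (j * int t) \<in> H \<inter> ?A"
      by (metis IntI rangeI)
    hence "a [^] (j * int t) = \<one>" unfolding HA by simp
    hence "int (ord a) dvd j * int t" using a by (simp add: int_pow_eq_id)
    hence "int d dvd j" using t \<open>t > 0\<close> by simp
    then obtain s where s: "j = int d * s" by blast
    (* Dividing x by the power s of a removes the component of x [^] d in the cyclic subgroup. *)
    define y where "y = x \<otimes> a [^] (- s)"
    have y: "y \<in> carrier G" using x a by (simp add: y_def)
    have "(a [^] (- s)) [^] int d = inv (a [^] j)"
      using a s by (simp add: int_pow_pow mult.commute flip: int_pow_neg)
    moreover have "y [^] int d = x [^] int d \<otimes> (a [^] (- s)) [^] int d"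
      unfolding y_def using x a by (intro int_pow_mult_distrib m_comm) auto
    ultimately have yd: "y [^] int d = h"
      using hc a by (simp add: int_pow_int xd m_assoc)
    have ydvd: "int d dvd k" if "y [^] k \<in> M" for k :: int
    proof (rule dvd)
      have "y [^] k \<otimes> a [^] (s * k) \<in> M"
        using that AM M by (meson rangeI subgroup.m_closed subsetD)
      also have "y [^] k = x [^] k \<otimes> a [^] (- s * k)"
        unfolding y_def using x a by (subst int_pow_mult_distrib) (auto simp: m_comm int_pow_pow)
      also have "\<dots> \<otimes> a [^] (s * k) = x [^] k"
        using x a by (simp add: m_assoc flip: int_pow_mult)
      finally show "x [^] k \<in> M" .
    qed
    define K where "K = H <#> range (\<lambda>i::int. y [^] i)"
    have K: "subgroup K G"
      unfolding K_def by (rule mult_subgroups[OF H subgroup_of_powers[OF y]])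
    have HK: "H \<subseteq> K" and yK: "range (\<lambda>i::int. y [^] i) \<subseteq> K"
      unfolding K_def by (rule subset_set_mult[OF H subgroup_of_powers[OF y]])+
    have "K \<inter> ?A \<subseteq> {\<one>}"
    proof
      fix z assume z: "z \<in> K \<inter> ?A"
      then obtain h' k where h': "h' \<in> H" and zk: "z = h' \<otimes> y [^] (k::int)"
        unfolding K_def set_mult_def by auto
      have h'c: "h' \<in> carrier G" using h' H by (rule subgroup.mem_carrier[rotated])
      have "y [^] k = inv h' \<otimes> z"
        using zk h'c y by (simp flip: m_assoc)
      also have "\<dots> \<in> M"
        using z AM HM h' M by (meson IntD2 subgroup.m_closed subgroup.m_inv_closed subsetD)
      finally have "int d dvd k" by (rule ydvd)
      then obtain r where "k = int d * r" by blast
      hence "y [^] k = h [^] r" using y yd by (metis int_pow_pow)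
      hence "z \<in> H" using zk h' h H by (simp add: subgroup.m_closed subgroup_int_pow_closed)
      thus "z \<in> {\<one>}" using z HA by blast
    qed
    hence "K \<in> \<H>"
      using K subgroup.one_closed[OF A] subgroup.one_closed[OF K] by (auto simp: \<H>_def)
    with maximal HK have "H = K" by blast
    have "y = y [^] (1::int)" using y by simp
    hence "y \<in> K" using yK by blast
    hence "y \<in> M" using \<open>H = K\<close> HM by blast
    hence "y \<otimes> a [^] s \<in> M" using AM M by (meson rangeI subgroup.m_closed subsetD)
    moreover have "y \<otimes> a [^] s = x"
      using x a by (simp add: y_def int_pow_neg m_assoc)
    ultimately show False using xM by simp
  qed
  hence "M = carrier G" using subgroup.subset[OF M] by blast
  with H HA that show thesis unfolding M_def by blast
qed

section \<open>Residue class rings\<close>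

lemma ideal_int_Idl: "ideal (Idl\<^bsub>\<Z>\<^esub> {k}) \<Z>"
  by (rule int.genideal_ideal) simp

lemma carrier_ZFact: "carrier (ZFact k) = range (ZMod k)"
  by (auto simp: ZFact_def FactRing_def A_RCOSETS_defs ZMod_def a_r_coset_defs r_coset_def)

lemma add_ZFact: "ZMod k x \<oplus>\<^bsub>ZFact k\<^esub> ZMod k y = ZMod k (x + y)"
  using ring_hom_add[OF ideal.rcos_ring_hom[OF ideal_int_Idl], of x y k]
  by (simp add: ZFact_def ZMod_def)

lemma mult_ZFact: "ZMod k x \<otimes>\<^bsub>ZFact k\<^esub> ZMod k y = ZMod k (x * y)"
  using ring_hom_mult[OF ideal.rcos_ring_hom[OF ideal_int_Idl], of x y k]
  by (simp add: ZFact_def ZMod_def)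

lemma one_ZFact: "\<one>\<^bsub>ZFact k\<^esub> = ZMod k 1"
  by (simp add: ZFact_def ZMod_def FactRing_def)

lemma zero_ZFact: "\<zero>\<^bsub>ZFact k\<^esub> = ZMod k 0"
  using ring_hom_zero[OF ideal.rcos_ring_hom[OF ideal_int_Idl], of k]
    cring.axioms(1)[OF int_is_cring] cring.axioms(1)[OF ZFact_is_cring[of k]]
  by (simp add: ZFact_def ZMod_def)

lemma ZMod_eq_iff: "ZMod k x = ZMod k y \<longleftrightarrow> [x = y] (mod k)"
  by (simp add: ZMod_eq_mod cong_def)

lemma ZMod_one_trivial: "ZMod 1 x = ZMod 1 y"
  by (simp add: ZMod_eq_iff)

lemma Units_ZFact: "Units (ZFact k) = ZMod k ` {x. coprime x k}"
proof -
  have "ZMod k x \<in> Units (ZFact k) \<longleftrightarrow> coprime x k" for x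
  proof -
    have "ZMod k x \<in> Units (ZFact k) \<longleftrightarrow> (\<exists>y. [y * x = 1] (mod k) \<and> [x * y = 1] (mod k))"
      by (auto simp: Units_def carrier_ZFact mult_ZFact one_ZFact ZMod_eq_iff)
    also have "\<dots> \<longleftrightarrow> coprime x k"
      by (simp add: mult.commute coprime_iff_invertible_int)
    finally show ?thesis .
  qed
  moreover have "Units (ZFact k) \<subseteq> range (ZMod k)"
    by (auto simp: Units_def simp flip: carrier_ZFact)
  ultimately show ?thesis by blast
qed

lemma finite_carrier_ZFact: "k \<noteq> 0 \<Longrightarrow> finite (carrier (ZFact k))"
proof -
  assume k: "k \<noteq> 0"
  have "range (ZMod k) \<subseteq> ZMod k ` {-\<bar>k\<bar>..\<bar>k\<bar>}"
  proof
    fix c assume "c \<in> range (ZMod k)"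
    then obtain x where "c = ZMod k x" by auto
    hence "c = ZMod k (x mod k)" using ZMod_mod by metis
    moreover have "x mod k \<in> {-\<bar>k\<bar>..\<bar>k\<bar>}"
      using abs_mod_less[OF k, of x] by auto
    ultimately show "c \<in> ZMod k ` {-\<bar>k\<bar>..\<bar>k\<bar>}" by auto
  qed
  thus ?thesis unfolding carrier_ZFact by (rule finite_subset) simp
qed

lemma ring_Zn: "ring (Zn_ring n)"
  using ZFact_is_cring by (rule cring.axioms(1))

lemma comm_group_units_Zn: "comm_group (units_of (Zn_ring n))"
  by (intro comm_monoid.units_comm_group cring.axioms(2) ZFact_is_cring)

lemma ZMod_some_cong: "[(SOME x. x \<in> ZMod k y) = y] (mod k)"
proof -
  have "y \<in> ZMod k y"
    unfolding ZMod_def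
    by (intro abelian_subgroup.a_rcos_self abelian_subgroupI3 ideal.axioms(1)[OF ideal_int_Idl]
        int.is_abelian_group) simp
  hence "(SOME x. x \<in> ZMod k y) \<in> ZMod k y" by (rule someI)
  then obtain t where "(SOME x. x \<in> ZMod k y) = t * k + y" using rcos_zfact by blast
  thus ?thesis by (simp add: cong_def)
qed

text \<open>Reduction of a class modulo \<open>k\<close> to a class modulo a divisor \<open>m\<close> of \<open>k\<close>. Any representative
of the given class may be used.\<close>

definition reduce_class :: "int \<Rightarrow> int set \<Rightarrow> int set"
  where "reduce_class m c = ZMod m (SOME x. x \<in> c)"

lemma reduce_class_ZMod: "m dvd k \<Longrightarrow> reduce_class m (ZMod k x) = ZMod m x"
  unfolding reduce_class_def ZMod_eq_iff by (rule cong_dvd_modulus[OF ZMod_some_cong])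

lemma RDirProd_simps:
  "(a, b) \<otimes>\<^bsub>RDirProd R S\<^esub> (c, d) = (a \<otimes>\<^bsub>R\<^esub> c, b \<otimes>\<^bsub>S\<^esub> d)"
  "(a, b) \<oplus>\<^bsub>RDirProd R S\<^esub> (c, d) = (a \<oplus>\<^bsub>R\<^esub> c, b \<oplus>\<^bsub>S\<^esub> d)"
  "\<one>\<^bsub>RDirProd R S\<^esub> = (\<one>\<^bsub>R\<^esub>, \<one>\<^bsub>S\<^esub>)"
  by (simp_all add: RDirProd_def DirProd_def monoid.defs)

lemma coprime_residue_iso:
  assumes cop: "coprime a b"
  shows "(\<lambda>c. (reduce_class a c, reduce_class b c))
    \<in> ring_iso (ZFact (a * b)) (RDirProd (ZFact a) (ZFact b))" (is "?h \<in> ring_iso ?R ?S")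
proof -
  have h: "?h (ZMod (a * b) x) = (ZMod a x, ZMod b x)" for x
    by (simp add: reduce_class_ZMod)
  have R: "\<exists>x. c = ZMod (a * b) x" if "c \<in> carrier ?R" for c
    using that by (auto simp: carrier_ZFact)
  show ?thesis
  proof (rule ring_iso_memI)
    fix c assume "c \<in> carrier ?R"
    then obtain x where c: "c = ZMod (a * b) x" by (metis R)
    show "?h c \<in> carrier ?S"
      unfolding c h by (simp add: RDirProd_carrier carrier_ZFact)
    fix d assume "d \<in> carrier ?R"
    then obtain y where d: "d = ZMod (a * b) y" by (metis R)
    show "?h (c \<otimes>\<^bsub>?R\<^esub> d) = ?h c \<otimes>\<^bsub>?S\<^esub> ?h d"
      unfolding c d mult_ZFact h RDirProd_simps ..
    show "?h (c \<oplus>\<^bsub>?R\<^esub> d) = ?h c \<oplus>\<^bsub>?S\<^esub> ?h d"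
      unfolding c d add_ZFact h RDirProd_simps ..
  next
    show "?h \<one>\<^bsub>?R\<^esub> = \<one>\<^bsub>?S\<^esub>"
      unfolding one_ZFact h RDirProd_simps ..
  next
    show "bij_betw ?h (carrier ?R) (carrier ?S)"
    proof (rule bij_betw_imageI)
      show "inj_on ?h (carrier ?R)"
      proof (rule inj_onI)
        fix c d assume "c \<in> carrier ?R" "d \<in> carrier ?R" and eq: "?h c = ?h d"
        then obtain x y where cd: "c = ZMod (a * b) x" "d = ZMod (a * b) y" by (metis R)
        have "[x = y] (mod a)" "[x = y] (mod b)"
          using eq unfolding cd h by (simp_all add: ZMod_eq_iff)
        hence "[x = y] (mod (a * b))" using cop by (simp add: coprime_cong_mult)
        thus "c = d" by (simp add: cd ZMod_eq_iff)
      qed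
      show "?h ` carrier ?R = carrier ?S"
      proof (rule equalityI; rule subsetI)
        fix z assume "z \<in> carrier ?S"
        then obtain x y where z: "z = (ZMod a x, ZMod b y)"
          by (auto simp: RDirProd_carrier carrier_ZFact)
        obtain w where "[w = x] (mod a)" "[w = y] (mod b)"
          using binary_chinese_remainder_int[OF cop] by blast
        hence "z = ?h (ZMod (a * b) w)" unfolding z h by (simp add: ZMod_eq_iff cong_sym)
        thus "z \<in> ?h ` carrier ?R" unfolding carrier_ZFact by blast
      next
        fix z assume "z \<in> ?h ` carrier ?R"
        then obtain x where "z = ?h (ZMod (a * b) x)" unfolding carrier_ZFact by blast
        thus "z \<in> carrier ?S" unfolding h by (simp add: RDirProd_carrier carrier_ZFact)
      qed
    qed
  qed
qed

text \<open>For \<open>f \<ge> 1\<close> an integer is coprime to \<open>q\<^sup>f\<close> exactly if it is coprime to the next power, so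
units lift along with any of their representatives; for \<open>f = 0\<close> the target is trivial.\<close>

lemma units_residue_epi:
  fixes q f :: nat
  defines "h \<equiv> reduce_class (int (q ^ f))"
  shows "h \<in> hom (units_of (Zn_ring (q ^ Suc f))) (units_of (Zn_ring (q ^ f)))"
    and "h ` carrier (units_of (Zn_ring (q ^ Suc f))) = carrier (units_of (Zn_ring (q ^ f)))"
proof -
  let ?G = "units_of (Zn_ring (q ^ Suc f))" and ?H = "units_of (Zn_ring (q ^ f))"
  have h: "h (ZMod (int (q ^ Suc f)) x) = ZMod (int (q ^ f)) x" for x
    unfolding h_def by (rule reduce_class_ZMod) simp
  have surj: "h ` carrier ?G = carrier ?H"
  proof -
    have "h ` carrier ?G = ZMod (int (q ^ f)) ` {x. coprime x (int (q ^ Suc f))}"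
      unfolding units_of_carrier Units_ZFact image_image h ..
    also have "\<dots> = ZMod (int (q ^ f)) ` {x. coprime x (int (q ^ f))}"
    proof (cases "f = 0")
      case True
      have "ZMod 1 ` S = {ZMod 1 1}" if "1 \<in> S" for S
        using that ZMod_one_trivial by blast
      with True show ?thesis by simp
    next
      case False
      thus ?thesis by simp
    qed
    finally show ?thesis unfolding units_of_carrier Units_ZFact .
  qed
  thus "h ` carrier ?G = carrier ?H" .
  show "h \<in> hom ?G ?H"
  proof (rule homI)
    fix c assume c: "c \<in> carrier ?G"
    show "h c \<in> carrier ?H" using surj c by blast
    fix d assume d: "d \<in> carrier ?G"
    obtain x y where "c = ZMod (int (q ^ Suc f)) x" "d = ZMod (int (q ^ Suc f)) y"
      using c d unfolding units_of_carrier Units_ZFact by blast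
    thus "h (c \<otimes>\<^bsub>?G\<^esub> d) = h c \<otimes>\<^bsub>?H\<^esub> h d"
      unfolding units_of_mult by (simp only: mult_ZFact h)
  qed
qed

section \<open>Direct sums of residue class rings\<close>

lemma ring_Zn_sum: "ring (Zn_ring_sum ns)"
  unfolding Zn_ring_sum_def by (rule RDirProd_list_is_ring) (simp add: ring_Zn)

lemma Zn_sum_Cons_iso:
  "(\<lambda>(c, cs). c # cs) \<in> ring_iso (RDirProd (Zn_ring n) (Zn_ring_sum ns)) (Zn_ring_sum (n # ns))"
  unfolding Zn_ring_sum_def list.map by (rule RDirProd_list_iso1)

lemma carrier_Zn_sum_Cons:
  "carrier (Zn_ring_sum (n # ns)) = (\<lambda>(c, cs). c # cs) ` (carrier (Zn_ring n) \<times> carrier (Zn_ring_sum ns))"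
  unfolding Zn_ring_sum_def list.map by (rule RDirProd_list_carrier)

lemma mult_Zn_sum_Cons:
  assumes "c \<in> carrier (Zn_ring n)" "cs \<in> carrier (Zn_ring_sum ns)"
    "d \<in> carrier (Zn_ring n)" "ds \<in> carrier (Zn_ring_sum ns)"
  shows "(c # cs) \<otimes>\<^bsub>Zn_ring_sum (n # ns)\<^esub> (d # ds) = (c \<otimes>\<^bsub>Zn_ring n\<^esub> d) # (cs \<otimes>\<^bsub>Zn_ring_sum ns\<^esub> ds)"
  using ring_iso_memE(2)[OF Zn_sum_Cons_iso, of "(c, cs)" n ns "(d, ds)"] assms
  by (simp add: RDirProd_carrier RDirProd_simps)

lemma Zn_sum_mult_comm:
  "x \<in> carrier (Zn_ring_sum ns) \<Longrightarrow> y \<in> carrier (Zn_ring_sum ns) \<Longrightarrow>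
    x \<otimes>\<^bsub>Zn_ring_sum ns\<^esub> y = y \<otimes>\<^bsub>Zn_ring_sum ns\<^esub> x"
proof (induction ns arbitrary: x y)
  case (Cons n ns)
  then obtain c cs d ds where "x = c # cs" "y = d # ds" "c \<in> carrier (Zn_ring n)" "d \<in> carrier (Zn_ring n)"
    "cs \<in> carrier (Zn_ring_sum ns)" "ds \<in> carrier (Zn_ring_sum ns)"
    unfolding carrier_Zn_sum_Cons by auto
  with Cons.IH show ?case
    by (simp add: mult_Zn_sum_Cons cring.cring_simprules(14)[OF ZFact_is_cring])
qed (simp add: Zn_ring_sum_def monoid.defs)

text \<open>Squaring is the identity modulo 1 and modulo 2 because \<open>y\<^sup>2 - y\<close> is always even.\<close>

lemma Zn_sum_idempotent:
  "\<forall>n\<in>set ns. n dvd 2 \<Longrightarrow> x \<in> carrier (Zn_ring_sum ns) \<Longrightarrow> x \<otimes>\<^bsub>Zn_ring_sum ns\<^esub> x = x"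
proof (induction ns arbitrary: x)
  case (Cons n ns)
  then obtain c cs where x: "x = c # cs" "c \<in> carrier (Zn_ring n)" "cs \<in> carrier (Zn_ring_sum ns)"
    unfolding carrier_Zn_sum_Cons by auto
  obtain y where c: "c = ZMod (int n) y" using x by (auto simp: carrier_ZFact)
  have "n dvd 2" using Cons.prems(1) by simp
  hence "int n dvd 2" by (metis int_dvd_int_iff of_nat_numeral)
  moreover have "2 dvd y * y - y" by simp
  ultimately have "int n dvd y * y - y" by (rule dvd_trans)
  hence "c \<otimes>\<^bsub>Zn_ring n\<^esub> c = c"
    by (simp add: c mult_ZFact ZMod_eq_iff cong_iff_dvd_diff)
  with Cons x show ?case by (simp add: mult_Zn_sum_Cons)
qed (simp add: Zn_ring_sum_def monoid.defs)

lemma finite_Zn_sum: "\<forall>n\<in>set ns. n \<ge> 1 \<Longrightarrow> finite (carrier (Zn_ring_sum ns))"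
proof (induction ns)
  case (Cons n ns)
  hence "finite (carrier (Zn_ring n))" by (intro finite_carrier_ZFact) auto
  with Cons show ?case unfolding carrier_Zn_sum_Cons by simp
qed (simp add: Zn_ring_sum_def)

lemma add_group: "ring R \<Longrightarrow> group (add_monoid R)"
  by (rule abelian_group.a_group) (rule ring.is_abelian_group)

lemma group_units: "ring R \<Longrightarrow> group (units_of R)"
  by (intro monoid.units_group ring.is_monoid)

lemma comm_group_units_Zn_sum: "comm_group (units_of (Zn_ring_sum ns))"
proof (rule group.group_comm_groupI[OF group_units[OF ring_Zn_sum]])
  fix x y assume "x \<in> carrier (units_of (Zn_ring_sum ns))" "y \<in> carrier (units_of (Zn_ring_sum ns))"
  hence "x \<in> carrier (Zn_ring_sum ns)" "y \<in> carrier (Zn_ring_sum ns)"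
    by (auto simp: units_of_carrier Units_def)
  thus "x \<otimes>\<^bsub>units_of (Zn_ring_sum ns)\<^esub> y = y \<otimes>\<^bsub>units_of (Zn_ring_sum ns)\<^esub> x"
    unfolding units_of_mult by (rule Zn_sum_mult_comm)
qed

lemma ring_iso_imp_add_iso: "h \<in> ring_iso R S \<Longrightarrow> h \<in> iso (add_monoid R) (add_monoid S)"
  by (auto simp: ring_iso_def ring_hom_def iso_def hom_def)

lemma ring_iso_Units:
  assumes "h \<in> ring_iso R S" "x \<in> Units R"
  shows "h x \<in> Units S"
proof -
  have hom: "h \<in> ring_hom R S"
    using assms by (auto simp: ring_iso_def)
  obtain y where "x \<in> carrier R" "y \<in> carrier R" "y \<otimes>\<^bsub>R\<^esub> x = \<one>\<^bsub>R\<^esub>" "x \<otimes>\<^bsub>R\<^esub> y = \<one>\<^bsub>R\<^esub>"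
    using assms(2) by (auto simp: Units_def)
  hence "h x \<in> carrier S" "h y \<in> carrier S" "h y \<otimes>\<^bsub>S\<^esub> h x = \<one>\<^bsub>S\<^esub>" "h x \<otimes>\<^bsub>S\<^esub> h y = \<one>\<^bsub>S\<^esub>"
    using hom by (metis ring_hom_closed, metis ring_hom_closed, metis ring_hom_mult ring_hom_one,
      metis ring_hom_mult ring_hom_one)
  thus ?thesis by (auto simp: Units_def)
qed

lemma ring_iso_imp_units_iso:
  assumes R: "ring R" and h: "h \<in> ring_iso R S"
  shows "h \<in> iso (units_of R) (units_of S)"
proof -
  have bij: "bij_betw h (carrier R) (carrier S)" and hom: "h \<in> ring_hom R S"
    using h by (auto simp: ring_iso_def)
  have UR: "Units R \<subseteq> carrier R" and US: "Units S \<subseteq> carrier S"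
    by (auto simp: Units_def)
  have "Units S \<subseteq> h ` Units R"
  proof
    fix y assume y: "y \<in> Units S"
    let ?x = "inv_into (carrier R) h y"
    have "?x \<in> Units R"
      using ring_iso_Units[OF ring_iso_set_sym[OF R h] y] .
    moreover have "h ?x = y"
      using y US bij by (meson bij_betw_inv_into_right subsetD)
    ultimately show "y \<in> h ` Units R" by (metis imageI)
  qed
  hence "bij_betw h (Units R) (Units S)"
    using bij UR ring_iso_Units[OF h] by (auto simp: bij_betw_def intro: inj_on_subset)
  moreover have "h (x \<otimes>\<^bsub>R\<^esub> y) = h x \<otimes>\<^bsub>S\<^esub> h y" if "x \<in> Units R" "y \<in> Units R" for x y
    using that UR hom by (meson ring_hom_mult subsetD)
  ultimately show ?thesis
    by (auto simp: iso_def hom_def units_of_def bij_betw_def)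
qed

lemma Units_RDirProd: "Units (RDirProd R S) = Units R \<times> Units S"
proof (rule equalityI; rule subsetI)
  fix z assume "z \<in> Units (RDirProd R S)"
  thus "z \<in> Units R \<times> Units S"
    by (auto simp: Units_def RDirProd_carrier RDirProd_simps)
next
  fix z assume "z \<in> Units R \<times> Units S"
  then obtain a b a' b' where "z = (a, b)" "a \<in> carrier R" "b \<in> carrier S" "a' \<in> carrier R" "b' \<in> carrier S"
    "a' \<otimes>\<^bsub>R\<^esub> a = \<one>\<^bsub>R\<^esub>" "a \<otimes>\<^bsub>R\<^esub> a' = \<one>\<^bsub>R\<^esub>" "b' \<otimes>\<^bsub>S\<^esub> b = \<one>\<^bsub>S\<^esub>" "b \<otimes>\<^bsub>S\<^esub> b' = \<one>\<^bsub>S\<^esub>"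
    by (auto simp: Units_def)
  thus "z \<in> Units (RDirProd R S)"
    unfolding Units_def
    by (auto simp: RDirProd_carrier RDirProd_simps intro!: bexI[of _ "(a', b')"])
qed

lemma units_of_RDirProd: "units_of (RDirProd R S) = units_of R \<times>\<times> units_of S"
proof -
  have "monoid.mult (RDirProd R S) = monoid.mult (R \<times>\<times> S)"
    by (simp add: RDirProd_def monoid.defs)
  thus ?thesis
    unfolding units_of_def Units_RDirProd RDirProd_simps by (simp add: DirProd_def)
qed

section \<open>Cyclic decompositions of finite abelian groups\<close>

lemma iso_cyclic_cons:
  fixes G (structure)
  assumes G: "comm_group G" and H: "subgroup H G" and a: "a \<in> carrier G" and n: "group.ord G a = n"
    and disjoint: "H \<inter> range (\<lambda>i::int. a [^] i) = {\<one>}"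
    and product: "H <#> range (\<lambda>i::int. a [^] i) = carrier G"
    and f: "f \<in> iso (add_monoid (Zn_ring_sum ns)) (G\<lparr>carrier := H\<rparr>)"
  shows "\<exists>h. h \<in> iso (add_monoid (Zn_ring_sum (n # ns))) G"
proof -
  interpret comm_group G by fact
  let ?A = "range (\<lambda>i::int. a [^] i)"
  interpret group_disjoint_sum G H ?A
    using H subgroup_of_powers[OF a] group_axioms by (simp add: group_disjoint_sum_def)
  let ?Z = "add_monoid (Zn_ring n)" and ?S = "add_monoid (Zn_ring_sum ns)"
  (* Independent of the representative because a has order n. *)
  define g where "g c = a [^] (SOME x. x \<in> c)" for c :: "int set"
  have g: "g (ZMod (int n) x) = a [^] x" for x
    unfolding g_def using ZMod_some_cong[of "int n" x] a n
    by (simp add: int_pow_eq cong_iff_dvd_diff dvd_diff_commute)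
  have eqZ: "ZMod (int n) x = ZMod (int n) y \<longleftrightarrow> a [^] x = a [^] y" for x y
    using a n by (simp add: int_pow_eq ZMod_eq_iff cong_iff_dvd_diff dvd_diff_commute)
  have fH: "f c \<in> H" if "c \<in> carrier ?S" for c
    using f that by (auto simp: iso_def hom_def)
  have fG: "f c \<in> carrier G" if "c \<in> carrier ?S" for c
    using fH[OF that] by simp
  have inj: "inj_on f (carrier ?S)" and img: "f ` carrier ?S = H"
    using f by (auto simp: iso_def bij_betw_def)
  have hom: "f (c \<otimes>\<^bsub>?S\<^esub> d) = f c \<otimes> f d" if "c \<in> carrier ?S" "d \<in> carrier ?S" for c d
    using f that by (auto simp: iso_def hom_def)
  define F where "F = (\<lambda>(c, cs). f cs \<otimes> g c)"
  have "F \<in> iso (?Z \<times>\<times> ?S) G"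
  proof (rule isoI)
    show "F \<in> hom (?Z \<times>\<times> ?S) G"
    proof (rule homI)
      fix x assume "x \<in> carrier (?Z \<times>\<times> ?S)"
      thus "F x \<in> carrier G"
        using fG a by (auto simp: F_def carrier_ZFact g)
    next
      fix x y assume "x \<in> carrier (?Z \<times>\<times> ?S)" "y \<in> carrier (?Z \<times>\<times> ?S)"
      then obtain i c j d where x: "x = (ZMod (int n) i, c)" "c \<in> carrier ?S"
        and y: "y = (ZMod (int n) j, d)" "d \<in> carrier ?S"
        by (auto simp: carrier_ZFact)
      have "F (x \<otimes>\<^bsub>?Z \<times>\<times> ?S\<^esub> y) = f (c \<otimes>\<^bsub>?S\<^esub> d) \<otimes> (a [^] i \<otimes> a [^] j)"
        using a by (simp add: x y F_def add_ZFact g int_pow_mult)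
      also have "\<dots> = F x \<otimes> F y"
        using hom[OF x(2) y(2)] fG[OF x(2)] fG[OF y(2)] a
        by (simp add: x(1) y(1) F_def g m_ac)
      finally show "F (x \<otimes>\<^bsub>?Z \<times>\<times> ?S\<^esub> y) = F x \<otimes> F y" .
    qed
    show "bij_betw F (carrier (?Z \<times>\<times> ?S)) (carrier G)"
    proof (rule bij_betw_imageI)
      show "inj_on F (carrier (?Z \<times>\<times> ?S))"
      proof (rule inj_onI)
        fix x y assume "x \<in> carrier (?Z \<times>\<times> ?S)" "y \<in> carrier (?Z \<times>\<times> ?S)" and F: "F x = F y"
        then obtain i c j d where x: "x = (ZMod (int n) i, c)" "c \<in> carrier ?S"
          and y: "y = (ZMod (int n) j, d)" "d \<in> carrier ?S"
          by (auto simp: carrier_ZFact)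
        have "f c \<otimes> a [^] i = f d \<otimes> a [^] j"
          using F by (simp add: x y F_def g)
        hence "f c = f d \<and> a [^] i = a [^] j"
          using cancel[THEN iffD1] disjoint fH[OF x(2)] fH[OF y(2)] by blast
        thus "x = y"
          using inj x y by (simp add: eqZ inj_on_eq_iff)
      qed
      show "F ` carrier (?Z \<times>\<times> ?S) = carrier G"
      proof -
        have "F ` carrier (?Z \<times>\<times> ?S) = f ` carrier ?S <#> ?A"
          by (force simp: F_def carrier_ZFact g set_mult_def image_iff)
        thus ?thesis unfolding img product .
      qed
    qed
  qed
  moreover have "Hilbert_Choice.inv (\<lambda>(c, cs). c # cs)
      \<in> iso (add_monoid (Zn_ring_sum (n # ns))) (?Z \<times>\<times> ?S)"
    using ring_iso_imp_add_iso[OF RDirProd_list_iso2[of "Zn_ring n" "map Zn_ring ns"]]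
    unfolding RDirProd_add_monoid Zn_ring_sum_def list.map .
  ultimately show ?thesis
    by (blast intro: iso_set_trans)
qed

text \<open>Existence part of the structure theorem, by induction on the order: an element whose order is the
exponent of the group generates a direct factor.\<close>

lemma finite_comm_group_cyclic_decomposition:
  assumes "comm_group G" "finite (carrier G)"
  shows "\<exists>d. cyclic_decomposition G d"
  using assms
proof (induction "card (carrier G)" arbitrary: G rule: less_induct)
  case (less G)
  interpret comm_group G by fact
  obtain a where a: "a \<in> carrier G" and exponent: "\<And>x. x \<in> carrier G \<Longrightarrow> ord x dvd ord a"
    by (rule exists_ord_eq_exponent[OF less.prems(2)]) blast
  show ?case
  proof (cases "a = \<one>\<^bsub>G\<^esub>")
    case True
    have "x = \<one>\<^bsub>G\<^esub>" if "x \<in> carrier G" for x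
      using exponent[OF that] ord_eq_1[OF that] ord_id True by (metis nat_dvd_1_iff_1)
    hence "carrier G = {\<one>\<^bsub>G\<^esub>}" by auto
    hence "cyclic_decomposition G ([], \<lambda>_. \<one>\<^bsub>G\<^esub>)"
      by (simp add: cyclic_decomposition_def Zn_ring_sum_def iso_def hom_def bij_betw_def)
    thus ?thesis ..
  next
    case False
    obtain H where H: "subgroup H G"
      and disjoint: "H \<inter> range (\<lambda>i::int. a [^]\<^bsub>G\<^esub> i) = {\<one>\<^bsub>G\<^esub>}"
      and product: "H <#>\<^bsub>G\<^esub> range (\<lambda>i::int. a [^]\<^bsub>G\<^esub> i) = carrier G"
      by (rule cyclic_subgroup_complement[OF less.prems(2) a exponent])
    have "a = a [^]\<^bsub>G\<^esub> (1::int)" using a by simp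
    hence "a \<notin> H" using disjoint False by blast
    hence "card H < card (carrier G)"
      using subgroup.subset[OF H] a less.prems(2) by (intro psubset_card_mono) auto
    moreover have "comm_group (G\<lparr>carrier := H\<rparr>)"
      using subgroup.subgroup_is_group[OF H is_group] subgroup.mem_carrier[OF H]
      by (intro group.group_comm_groupI) (auto simp: m_comm)
    moreover have "finite H"
      using finite_subset[OF subgroup.subset[OF H] less.prems(2)] .
    ultimately obtain ns f where "cyclic_decomposition (G\<lparr>carrier := H\<rparr>) (ns, f)"
      using less.hyps[of "G\<lparr>carrier := H\<rparr>"] by auto
    hence ns: "\<forall>m\<in>set ns. m \<ge> 1" and f: "f \<in> iso (add_monoid (Zn_ring_sum ns)) (G\<lparr>carrier := H\<rparr>)"
      by (auto simp: cyclic_decomposition_def)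
    obtain h where "h \<in> iso (add_monoid (Zn_ring_sum (ord a # ns))) G"
      using iso_cyclic_cons[OF less.prems(1) H a refl disjoint product f] by blast
    hence "cyclic_decomposition G (ord a # ns, h)"
      using ns ord_ge_1[OF less.prems(2) a] by (auto simp: cyclic_decomposition_def)
    thus ?thesis ..
  qed
qed

section \<open>Growth of torsion\<close>

definition torsion_count :: "('a, 'b) monoid_scheme \<Rightarrow> nat \<Rightarrow> nat"
  where "torsion_count G d = card {x \<in> carrier G. x [^]\<^bsub>G\<^esub> d = \<one>\<^bsub>G\<^esub>}"

lemma torsion_count_iso:
  assumes "group G" "group H" "h \<in> iso G H"
  shows "torsion_count H d = torsion_count G d"
proof -
  interpret group_hom G H h
    using assms by (simp add: group_hom_def group_hom_axioms_def iso_imp_homomorphism)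
  have bij: "bij_betw h (carrier G) (carrier H)" using assms by (simp add: iso_def)
  have "h x [^]\<^bsub>H\<^esub> d = \<one>\<^bsub>H\<^esub> \<longleftrightarrow> x [^]\<^bsub>G\<^esub> d = \<one>\<^bsub>G\<^esub>" if x: "x \<in> carrier G" for x
  proof -
    have "h x [^]\<^bsub>H\<^esub> d = \<one>\<^bsub>H\<^esub> \<longleftrightarrow> h (x [^]\<^bsub>G\<^esub> d) = h \<one>\<^bsub>G\<^esub>"
      using x by (simp add: hom_nat_pow)
    also have "\<dots> \<longleftrightarrow> x [^]\<^bsub>G\<^esub> d = \<one>\<^bsub>G\<^esub>"
      using x bij by (intro inj_on_eq_iff[of h "carrier G"]) (auto simp: bij_betw_def)
    finally show ?thesis .
  qed
  hence "bij_betw h {x \<in> carrier G. x [^]\<^bsub>G\<^esub> d = \<one>\<^bsub>G\<^esub>} {y \<in> carrier H. y [^]\<^bsub>H\<^esub> d = \<one>\<^bsub>H\<^esub>}"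
    using bij by (intro bij_betw_Collect) auto
  thus ?thesis unfolding torsion_count_def by (simp add: bij_betw_same_card)
qed

lemma nat_pow_DirProd: "(x, y) [^]\<^bsub>G \<times>\<times> H\<^esub> (d::nat) = (x [^]\<^bsub>G\<^esub> d, y [^]\<^bsub>H\<^esub> d)"
  by (induction d) (simp_all add: nat_pow_def DirProd_def)

lemma torsion_count_DirProd:
  "torsion_count (G \<times>\<times> H) d = torsion_count G d * torsion_count H d"
proof -
  have "{x \<in> carrier (G \<times>\<times> H). x [^]\<^bsub>G \<times>\<times> H\<^esub> d = \<one>\<^bsub>G \<times>\<times> H\<^esub>} =
    {x \<in> carrier G. x [^]\<^bsub>G\<^esub> d = \<one>\<^bsub>G\<^esub>} \<times> {x \<in> carrier H. x [^]\<^bsub>H\<^esub> d = \<one>\<^bsub>H\<^esub>}"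
    by (auto simp: nat_pow_DirProd)
  thus ?thesis by (simp add: torsion_count_def card_cartesian_product)
qed

lemma torsion_count_pos:
  fixes G (structure)
  assumes "group G" "finite (carrier G)" shows "torsion_count G d > 0"
proof -
  interpret group G by fact
  have "\<one> \<in> {x \<in> carrier G. x [^] d = \<one>}" by simp
  thus ?thesis using assms by (auto simp: torsion_count_def card_gt_0_iff)
qed

text \<open>The ratio is used because the number of solutions of \<open>p\<^sup>e x = 0\<close> in a sum of cyclic
groups depends on the ranks at all exponents up to \<open>e\<close>, whereas the ratio isolates one of them.\<close>

definition torsion_growth :: "('a, 'b) monoid_scheme \<Rightarrow> nat \<Rightarrow> nat \<Rightarrow> real"
  where "torsion_growth G p e = real (torsion_count G (p ^ Suc e)) / real (torsion_count G (p ^ e))"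

lemma torsion_growth_iso:
  assumes "group G" "group H" "h \<in> iso G H"
  shows "torsion_growth H p e = torsion_growth G p e"
  using assms by (simp add: torsion_growth_def torsion_count_iso)

lemma torsion_growth_DirProd:
  "torsion_growth (G \<times>\<times> H) p e = torsion_growth G p e * torsion_growth H p e"
  by (simp add: torsion_growth_def torsion_count_DirProd)

lemma torsion_growth_singleton:
  assumes "carrier G = {\<one>\<^bsub>G\<^esub>}" "group G"
  shows "torsion_growth G p e = 1"
proof -
  have "torsion_count G d = 1" for d
  proof -
    have "{x \<in> carrier G. x [^]\<^bsub>G\<^esub> d = \<one>\<^bsub>G\<^esub>} = {\<one>\<^bsub>G\<^esub>}"
      using assms(1) monoid.nat_pow_one[OF group.is_monoid[OF assms(2)], of d] by auto
    thus ?thesis by (simp add: torsion_count_def)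
  qed
  thus ?thesis by (simp add: torsion_growth_def)
qed

lemma (in group_hom) card_image_mult_card_kernel:
  assumes "finite (carrier G)"
  shows "card (h ` carrier G) * card (kernel G H h) = card (carrier G)"
proof -
  let ?I = "H\<lparr>carrier := h ` carrier G\<rparr>"
  have "group_hom G ?I h"
    by (intro group_hom.intro group_hom_axioms.intro G.is_group
        subgroup.subgroup_is_group[OF img_is_subgroup H.is_group]) (auto simp: hom_def)
  from group_hom.FactGroup_iso_set[OF this]
  have "(\<lambda>C. the_elem (h ` C)) \<in> iso (G Mod kernel G H h) ?I"
    by (simp add: kernel_def)
  hence "card (rcosets kernel G H h) = card (h ` carrier G)"
    by (auto simp: iso_def FactGroup_def dest: bij_betw_same_card)
  thus ?thesis
    using G.lagrange[OF subgroup_kernel] by (simp add: order_def mult.commute)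
qed

lemma (in comm_group) torsion_count_mult_card_powers:
  assumes "finite (carrier G)"
  shows "torsion_count G d * card ((\<lambda>x. x [^] d) ` carrier G) = card (carrier G)"
proof -
  interpret P: group_hom G G "\<lambda>x. x [^] d"
    by unfold_locales (auto simp: hom_def pow_mult_distrib m_comm)
  show ?thesis
    using P.card_image_mult_card_kernel[OF assms] by (simp add: kernel_def torsion_count_def mult.commute)
qed

lemma (in comm_group) subgroup_of_dth_powers:
  "subgroup ((\<lambda>x. x [^] (d::nat)) ` carrier G) G"
proof -
  interpret P: group_hom G G "\<lambda>x. x [^] d"
    by unfold_locales (auto simp: hom_def pow_mult_distrib m_comm)
  show ?thesis by (rule P.img_is_subgroup)
qed

text \<open>Write \<open>G\<^sup>d\<close> for the group of \<open>d\<close>-th powers. It has index \<open>torsion_count G d\<close>, so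
the quotient of the torsion counts at \<open>s t\<close> and at \<open>s\<close> is the index of
\<open>G\<^sup>s\<^sup>t\<close> in \<open>G\<^sup>s\<close>. The homomorphism maps these two groups onto the corresponding ones
of \<open>H\<close>, with kernels the smaller of which lies in the larger, so the index cannot increase.
The inequality is stated without division.\<close>

lemma torsion_quotient_mono_epi:
  assumes G: "comm_group G" and H: "comm_group H" and fin: "finite (carrier G)"
    and hom: "h \<in> hom G H" and surj: "h ` carrier G = carrier H"
  shows "torsion_count H (s * t) * torsion_count G s \<le> torsion_count G (s * t) * torsion_count H s"
proof -
  interpret G: comm_group G by fact
  interpret H: comm_group H by fact
  interpret group_hom G H h by unfold_locales fact
  define P where "P d = (\<lambda>x. x [^]\<^bsub>G\<^esub> d) ` carrier G" for d :: nat
  define K where "K d = card {x \<in> P d. h x = \<one>\<^bsub>H\<^esub>}" for d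
  have fin_H: "finite (carrier H)" using fin surj by (metis finite_imageI)
  have P_sub: "P d \<subseteq> carrier G" for d by (auto simp: P_def)
  have fin_P: "finite (P d)" for d using P_sub fin by (rule finite_subset)
  have P_eq: "card (P d) = card (h ` P d) * K d" for d
  proof -
    interpret P: group_hom "G\<lparr>carrier := P d\<rparr>" H h
      unfolding P_def
      by (intro group_hom.intro group_hom_axioms.intro H.is_group
          subgroup.subgroup_is_group[OF G.subgroup_of_dth_powers G.is_group]) (auto simp: hom_def)
    show ?thesis using P.card_image_mult_card_kernel fin_P[of d] by (simp add: kernel_def K_def)
  qed
  have K_pos: "K d > 0" for d
  proof -
    have "card (P d) > 0"
      using fin_P[of d] by (auto simp: card_gt_0_iff P_def)
    thus ?thesis using P_eq[of d] by (metis gr0I mult_0_right less_irrefl)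
  qed
  have img: "h ` P d = (\<lambda>y. y [^]\<^bsub>H\<^esub> d) ` carrier H" for d
    unfolding surj[symmetric] P_def image_image by (intro image_cong) (simp_all add: hom_nat_pow)
  have tG: "torsion_count G d * (card (h ` P d) * K d) = card (carrier G)" for d
    using G.torsion_count_mult_card_powers[OF fin, of d] P_eq[of d] by (simp add: P_def)
  have tH: "torsion_count H d * card (h ` P d) = card (carrier H)" for d
    using H.torsion_count_mult_card_powers[OF fin_H, of d] by (simp add: img)
  have "P (s * t) \<subseteq> P s"
  proof
    fix y assume "y \<in> P (s * t)"
    then obtain x where x: "x \<in> carrier G" "y = x [^]\<^bsub>G\<^esub> (t * s)"
      by (auto simp: P_def mult.commute)
    hence "y = (x [^]\<^bsub>G\<^esub> t) [^]\<^bsub>G\<^esub> s" by (simp add: G.nat_pow_pow)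
    thus "y \<in> P s" using x by (auto simp: P_def)
  qed
  hence "K (s * t) \<le> K s"
    unfolding K_def using fin_P by (intro card_mono) auto
  define a b where "a = card (h ` P s)" and "b = card (h ` P (s * t))"
  define g k where "g = card (carrier G)" and "k = card (carrier H)"
  have gs: "torsion_count G s * (a * K s) = g" and gst: "torsion_count G (s * t) * (b * K (s * t)) = g"
    and hs: "torsion_count H s * a = k" and hst: "torsion_count H (s * t) * b = k"
    using tG tH by (simp_all add: a_def b_def g_def k_def)
  have "g > 0" using fin by (auto simp: g_def card_gt_0_iff)
  have ab: "a > 0" "b > 0" using gs gst \<open>g > 0\<close> by (auto intro: gr0I)
  have "(torsion_count H (s * t) * torsion_count G s) * (a * b * K s) = k * g"
    using gs hst by (metis mult.assoc mult.commute mult.left_commute)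
  also have "\<dots> = (torsion_count G (s * t) * torsion_count H s) * (a * b * K (s * t))"
    using gst hs by (metis mult.assoc mult.commute mult.left_commute)
  also have "\<dots> \<le> (torsion_count G (s * t) * torsion_count H s) * (a * b * K s)"
    using \<open>K (s * t) \<le> K s\<close> by simp
  finally show ?thesis using ab K_pos[of s] by simp
qed

lemma torsion_growth_epi:
  assumes "comm_group G" "comm_group H" "finite (carrier G)"
    and "h \<in> hom G H" "h ` carrier G = carrier H"
  shows "torsion_growth H p e \<le> torsion_growth G p e"
proof -
  have "finite (carrier H)" using assms(3,5) by (metis finite_imageI)
  hence "torsion_count G (p ^ e) > 0" "torsion_count H (p ^ e) > 0"
    using assms by (simp_all add: torsion_count_pos comm_group.axioms(2))
  moreover have "real (torsion_count H (p ^ e * p) * torsion_count G (p ^ e))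
      \<le> real (torsion_count G (p ^ e * p) * torsion_count H (p ^ e))"
    using torsion_quotient_mono_epi[OF assms] by (intro of_nat_mono)
  ultimately show ?thesis
    by (simp add: torsion_growth_def divide_simps mult.commute)
qed

section \<open>Torsion growth in unit groups\<close>

lemma torsion_growth_units_Zn_sum:
  "torsion_growth (units_of (Zn_ring_sum ns)) p e =
    prod_list (map (\<lambda>n. torsion_growth (units_of (Zn_ring n)) p e) ns)"
proof (induction ns)
  case Nil
  have "Units (Zn_ring_sum []) = {\<one>\<^bsub>Zn_ring_sum []\<^esub>}"
    by (auto simp: Zn_ring_sum_def Units_def monoid.defs)
  hence "carrier (units_of (Zn_ring_sum [])) = {\<one>\<^bsub>units_of (Zn_ring_sum [])\<^esub>}"
    by (simp add: units_of_def)
  thus ?case by (simp add: torsion_growth_singleton group_units ring_Zn_sum)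
next
  case (Cons n ns)
  have ring: "ring (RDirProd (Zn_ring n) (Zn_ring_sum ns))"
    by (intro RDirProd_ring ring_Zn ring_Zn_sum)
  show ?case
    using torsion_growth_iso[OF group_units[OF ring] group_units[OF ring_Zn_sum]
        ring_iso_imp_units_iso[OF ring Zn_sum_Cons_iso]] Cons.IH
    by (simp add: units_of_RDirProd torsion_growth_DirProd)
qed

lemma torsion_growth_units_Zn_coprime:
  assumes "coprime a b"
  shows "torsion_growth (units_of (Zn_ring (a * b))) p e =
    torsion_growth (units_of (Zn_ring a)) p e * torsion_growth (units_of (Zn_ring b)) p e"
proof -
  have ring: "ring (RDirProd (Zn_ring a) (Zn_ring b))"
    by (intro RDirProd_ring ring_Zn)
  have "coprime (int a) (int b)" using assms by simp
  from coprime_residue_iso[OF this]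
  have "(\<lambda>c. (reduce_class (int a) c, reduce_class (int b) c))
      \<in> ring_iso (Zn_ring (a * b)) (RDirProd (Zn_ring a) (Zn_ring b))"
    by simp
  from torsion_growth_iso[OF group_units[OF ring_Zn] group_units[OF ring]
      ring_iso_imp_units_iso[OF ring_Zn this]]
  show ?thesis
    by (simp add: units_of_RDirProd torsion_growth_DirProd)
qed

section \<open>Torsion growth in additive groups\<close>

lemma nat_pow_add_ZFact: "ZMod k x [^]\<^bsub>add_monoid (ZFact k)\<^esub> (d::nat) = ZMod k (int d * x)"
  by (induction d) (simp_all add: nat_pow_def zero_ZFact add_ZFact algebra_simps)

text \<open>With \<open>g = gcd d n\<close> the solutions of \<open>d x = 0\<close> modulo \<open>n\<close> are the \<open>g\<close> classes
of multiples of \<open>n div g\<close>.\<close>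

lemma torsion_count_ZFact:
  assumes "n \<ge> 1"
  shows "torsion_count (add_monoid (ZFact (int n))) d = gcd d n"
proof -
  define g where "g = gcd (int d) (int n)"
  define m where "m = int n div g"
  have n: "int n = g * m" and g: "g > 0" and m: "m > 0"
    using assms by (auto simp: g_def m_def pos_imp_zdiv_pos_iff zdvd_imp_le)
  have dvd: "int n dvd int d * x \<longleftrightarrow> m dvd x" for x
  proof -
    have "int d = (int d div g) * g" by (simp add: g_def)
    hence "int n dvd int d * x \<longleftrightarrow> m * g dvd (int d div g * x) * g"
      using n by (metis mult.commute mult.assoc)
    also have "\<dots> \<longleftrightarrow> m dvd (int d div g) * x"
      using g by (subst dvd_times_right_cancel_iff) auto
    also have "\<dots> \<longleftrightarrow> m dvd x"
      using div_gcd_coprime[of "int d" "int n"] assms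
      by (intro coprime_dvd_mult_right_iff) (auto simp: m_def g_def coprime_commute)
    finally show ?thesis .
  qed
  let ?Z = "add_monoid (ZFact (int n))"
  have torsion: "ZMod (int n) x [^]\<^bsub>?Z\<^esub> d = \<one>\<^bsub>?Z\<^esub> \<longleftrightarrow> m dvd x" for x
    unfolding nat_pow_add_ZFact by (simp add: zero_ZFact ZMod_eq_iff cong_0_iff dvd)
  have carrier: "carrier ?Z = range (ZMod (int n))"
    by (simp add: carrier_ZFact)
  have "{c \<in> carrier ?Z. c [^]\<^bsub>?Z\<^esub> d = \<one>\<^bsub>?Z\<^esub>} = ZMod (int n) ` {x \<in> UNIV. m dvd x}"
    unfolding carrier Compr_image_eq torsion ..
  also have "\<dots> = ZMod (int n) ` {x. m dvd x}" by simp
  also have "\<dots> = (\<lambda>j. ZMod (int n) (j * m)) ` {0..<g}"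
  proof (rule equalityI; rule subsetI)
    fix c assume "c \<in> ZMod (int n) ` {x. m dvd x}"
    then obtain j where "c = ZMod (int n) (j * m)" by (auto simp: dvd_def mult.commute)
    moreover have "[j * m = (j mod g) * m] (mod (g * m))"
      using m by (simp add: cong_def mult_mod_left flip: mod_mult_mult2)
    ultimately have "c = ZMod (int n) ((j mod g) * m)"
      by (simp add: ZMod_eq_iff n)
    thus "c \<in> (\<lambda>j. ZMod (int n) (j * m)) ` {0..<g}" using g by auto
  qed auto
  also have "card \<dots> = card {0..<g}"
  proof (rule card_image, rule inj_onI)
    fix i j assume "i \<in> {0..<g}" "j \<in> {0..<g}" "ZMod (int n) (i * m) = ZMod (int n) (j * m)"
    moreover from this have "i mod g = j mod g"
      using m by (simp add: ZMod_eq_iff n cong_def mod_mult_mult2)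
    ultimately show "i = j" by simp
  qed
  finally show ?thesis
    by (simp add: torsion_count_def g_def)
qed

lemma torsion_count_add_RDirProd: "torsion_count (add_monoid (RDirProd R S)) d =
    torsion_count (add_monoid R) d * torsion_count (add_monoid S) d"
  unfolding RDirProd_add_monoid by (rule torsion_count_DirProd)

lemma torsion_count_add_Zn_sum:
  assumes "\<forall>n\<in>set ns. n \<ge> 1"
  shows "torsion_count (add_monoid (Zn_ring_sum ns)) d = prod_list (map (gcd d) ns)"
  using assms
proof (induction ns)
  case Nil
  have "{x \<in> carrier (add_monoid (Zn_ring_sum [])). x [^]\<^bsub>add_monoid (Zn_ring_sum [])\<^esub> d = \<one>\<^bsub>add_monoid (Zn_ring_sum [])\<^esub>} = {[]}"
    using monoid.nat_pow_one[OF group.is_monoid[OF add_group[OF ring_Zn_sum[of "[]"]]], of d]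
    by (auto simp: Zn_ring_sum_def monoid.defs)
  thus ?case by (simp add: torsion_count_def)
next
  case (Cons n ns)
  hence n: "n \<ge> 1" and ns: "\<forall>n\<in>set ns. n \<ge> 1" by auto
  have ring: "ring (RDirProd (Zn_ring n) (Zn_ring_sum ns))"
    by (intro RDirProd_ring ring_Zn ring_Zn_sum)
  show ?case
    unfolding torsion_count_iso[OF add_group[OF ring] add_group[OF ring_Zn_sum]
        ring_iso_imp_add_iso[OF Zn_sum_Cons_iso]] torsion_count_add_RDirProd
      Cons.IH[OF ns] torsion_count_ZFact[OF n] by simp
qed

text \<open>For a prime \<open>q\<close> and \<open>f \<ge> 1\<close> this is the dimension, over the field with \<open>q\<close> elements, of
\<open>q\<^sup>f\<^sup>-\<^sup>1 A\<close> modulo \<open>q\<^sup>f A\<close>, where \<open>A\<close> is the direct sum of the cyclic groups with orders \<open>ns\<close>.\<close>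

definition prime_power_rank :: "nat \<Rightarrow> nat \<Rightarrow> nat list \<Rightarrow> nat"
  where "prime_power_rank q f ns = length (filter (\<lambda>n. q ^ f dvd n) ns)"

lemma gcd_prime_power_Suc:
  fixes p n :: nat
  assumes p: "Factorial_Ring.prime p"
  shows "gcd (p ^ Suc e) n = (if p ^ Suc e dvd n then p else 1) * gcd (p ^ e) n"
proof (cases "p ^ Suc e dvd n")
  case True
  hence "p ^ e dvd n" by (rule dvd_trans[rotated]) simp
  with True show ?thesis by (simp add: gcd_nat.absorb1)
next
  case False
  obtain j where j: "gcd (p ^ Suc e) n = p ^ j"
    using divides_primepow_nat[OF p, of "gcd (p ^ Suc e) n" "Suc e"] by auto
  have "j \<le> e"
  proof (rule ccontr)
    assume "\<not> j \<le> e"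
    hence "p ^ Suc e dvd p ^ j" by (intro le_imp_power_dvd) simp
    also have "p ^ j dvd n" by (metis j gcd_dvd2)
    finally show False using False by simp
  qed
  hence "gcd (p ^ Suc e) n dvd p ^ e" unfolding j by (rule le_imp_power_dvd)
  hence "gcd (p ^ Suc e) n = gcd (p ^ e) n"
    by (intro dvd_antisym) (auto intro: dvd_trans[of _ "p ^ e"])
  with False show ?thesis by simp
qed

lemma torsion_growth_add_Zn_sum:
  assumes ns: "\<forall>n\<in>set ns. n \<ge> 1" and p: "Factorial_Ring.prime p"
  shows "torsion_growth (add_monoid (Zn_ring_sum ns)) p e = real p ^ prime_power_rank p (Suc e) ns"
proof -
  have "prod_list (map (gcd (p ^ Suc e)) ns) = p ^ prime_power_rank p (Suc e) ns * prod_list (map (gcd (p ^ e)) ns)"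
    by (induction ns) (simp_all add: prime_power_rank_def gcd_prime_power_Suc[OF p] del: power_Suc, simp_all)
  moreover have "prod_list (map (gcd (p ^ e)) ns) > 0"
    using ns by (induction ns) auto
  ultimately show ?thesis
    unfolding torsion_growth_def torsion_count_add_Zn_sum[OF ns] by (simp del: power_Suc)
qed

section \<open>Products of multiplicative functions over lists of moduli\<close>

lemma multiplicative_prod_prime_powers:
  fixes L :: "nat \<Rightarrow> real"
  assumes one: "L 1 = 1"
    and mult: "\<And>a b. a \<ge> 1 \<Longrightarrow> b \<ge> 1 \<Longrightarrow> coprime a b \<Longrightarrow> L (a * b) = L a * L b"
    and "finite A" "\<And>q. q \<in> A \<Longrightarrow> Factorial_Ring.prime q"
  shows "L (\<Prod>q\<in>A. q ^ v q) = (\<Prod>q\<in>A. L (q ^ v q))"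
  using assms(3,4)
proof (induction A rule: finite_induct)
  case (insert q A)
  have "coprime (q ^ v q) (\<Prod>q\<in>A. q ^ v q)"
    using insert by (intro prod_coprime_right) (metis coprime_power_left_iff coprime_power_right_iff insertCI primes_coprime)
  moreover have "(\<Prod>q\<in>A. q ^ v q) \<ge> 1"
    using insert.prems by (simp add: Suc_le_eq prime_gt_0_nat prod_pos)
  moreover have "q ^ v q \<ge> 1"
    using insert.prems by (simp add: Suc_le_eq prime_gt_0_nat)
  ultimately show ?case using insert mult by simp
qed (use one in simp)

text \<open>The value at a prime power is a telescoping product of the quotients of values at consecutive powers,
so that only conditions \<open>q\<^sup>f dvd n\<close> are left, which can be counted over a list.\<close>

lemma multiplicative_increment_product:
  fixes L :: "nat \<Rightarrow> real"
  assumes one: "L 1 = 1"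
    and mult: "\<And>a b. a \<ge> 1 \<Longrightarrow> b \<ge> 1 \<Longrightarrow> coprime a b \<Longrightarrow> L (a * b) = L a * L b"
    and pos: "\<And>n. n \<ge> 1 \<Longrightarrow> L n > 0"
    and n: "n \<ge> 1" "n \<le> N"
  shows "L n = (\<Prod>q | Factorial_Ring.prime q \<and> q \<le> N. \<Prod>f = 1..N. if q ^ f dvd n then L (q ^ f) / L (q ^ (f - 1)) else 1)"
proof -
  let ?A = "{q. Factorial_Ring.prime q \<and> q \<le> N}"
  have fin: "finite ?A" by simp
  have "n = (\<Prod>q\<in>prime_factors n. q ^ multiplicity q n)"
    using n by (simp add: prime_factorization_nat[symmetric])
  also have "\<dots> = (\<Prod>q\<in>?A. q ^ multiplicity q n)"
    using n by (intro prod.mono_neutral_left) 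
      (auto simp: in_prime_factors_iff not_dvd_imp_multiplicity_0 dest!: dvd_imp_le)
  finally have "L n = (\<Prod>q\<in>?A. L (q ^ multiplicity q n))"
    using multiplicative_prod_prime_powers[OF one mult fin, of "\<lambda>q. multiplicity q n"] by auto
  also have "\<dots> = (\<Prod>q\<in>?A. \<Prod>f = 1..N. if q ^ f dvd n then L (q ^ f) / L (q ^ (f - 1)) else 1)"
  proof (rule prod.cong[OF refl])
    fix q assume "q \<in> ?A"
    hence q: "Factorial_Ring.prime q" by simp
    have Lq: "L (q ^ v) > 0" for v using q by (intro pos) (simp add: Suc_le_eq prime_gt_0_nat)
    have telescope: "(\<Prod>f = 1..v. L (q ^ f) / L (q ^ (f - 1))) = L (q ^ v)" for v
      using Lq one by (induction v) (auto simp: less_imp_neq[THEN not_sym])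
    define v where "v = multiplicity q n"
    have dvd: "q ^ f dvd n \<longleftrightarrow> f \<le> v" for f
      unfolding v_def using n q by (intro power_dvd_iff_le_multiplicity) auto
    have "v < q ^ v" using prime_gt_1_nat[OF q] by (intro power_gt_expt) simp
    also have "q ^ v \<le> N" using dvd[of v] n by (meson dvd_imp_le le_refl order_trans zero_less_one less_le_trans)
    finally have "v \<le> N" by simp
    have "L (q ^ v) = (\<Prod>f = 1..v. L (q ^ f) / L (q ^ (f - 1)))" by (simp only: telescope)
    also have "\<dots> = (\<Prod>f = 1..N. if f \<le> v then L (q ^ f) / L (q ^ (f - 1)) else 1)"
      using \<open>v \<le> N\<close> by (intro prod.mono_neutral_cong_left) auto
    finally show "L (q ^ multiplicity q n) = (\<Prod>f = 1..N. if q ^ f dvd n then L (q ^ f) / L (q ^ (f - 1)) else 1)"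
      by (simp add: dvd v_def)
  qed
  finally show ?thesis .
qed

lemma prod_list_increments:
  fixes L :: "nat \<Rightarrow> real"
  assumes one: "L 1 = 1"
    and mult: "\<And>a b. a \<ge> 1 \<Longrightarrow> b \<ge> 1 \<Longrightarrow> coprime a b \<Longrightarrow> L (a * b) = L a * L b"
    and pos: "\<And>n. n \<ge> 1 \<Longrightarrow> L n > 0"
    and ns: "\<forall>n\<in>set ns. 1 \<le> n \<and> n \<le> N"
  shows "prod_list (map L ns) =
    (\<Prod>q | Factorial_Ring.prime q \<and> q \<le> N. \<Prod>f = 1..N. (L (q ^ f) / L (q ^ (f - 1))) ^ prime_power_rank q f ns)"
  using ns
proof (induction ns)
  case (Cons n ns)
  have "prod_list (map L (n # ns)) = L n * prod_list (map L ns)" by simp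
  also have "L n = (\<Prod>q | Factorial_Ring.prime q \<and> q \<le> N. \<Prod>f = 1..N. if q ^ f dvd n then L (q ^ f) / L (q ^ (f - 1)) else 1)"
    using Cons.prems by (intro multiplicative_increment_product[OF one mult pos]) auto
  also have "prod_list (map L ns) = (\<Prod>q | Factorial_Ring.prime q \<and> q \<le> N. \<Prod>f = 1..N. (L (q ^ f) / L (q ^ (f - 1))) ^ prime_power_rank q f ns)"
    using Cons by simp
  finally show ?case
    by (simp flip: prod.distrib) (intro prod.cong; simp add: prime_power_rank_def)
qed (simp add: prime_power_rank_def)

text \<open>The product over a list depends on the ranks alone, and monotonically so, since
\<open>L\<close> does not decrease along the powers of a prime.\<close>

lemma prod_list_mono_prime_power_rank:
  fixes L :: "nat \<Rightarrow> real"
  assumes one: "L 1 = 1"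
    and mult: "\<And>a b. a \<ge> 1 \<Longrightarrow> b \<ge> 1 \<Longrightarrow> coprime a b \<Longrightarrow> L (a * b) = L a * L b"
    and pos: "\<And>n. n \<ge> 1 \<Longrightarrow> L n > 0"
    and mono: "\<And>q f. Factorial_Ring.prime q \<Longrightarrow> L (q ^ f) \<le> L (q ^ Suc f)"
    and ms: "\<forall>m\<in>set ms. m \<ge> 1" and ns: "\<forall>n\<in>set ns. n \<ge> 1"
    and ranks: "\<And>q f. Factorial_Ring.prime q \<Longrightarrow> f \<ge> 1 \<Longrightarrow> prime_power_rank q f ms \<le> prime_power_rank q f ns"
  shows "prod_list (map L ms) \<le> prod_list (map L ns)"
proof -
  (* A common bound for all entries, hence for the primes and the exponents involved. *)
  define N where "N = sum_list (ms @ ns)"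
  have N: "n \<le> N" if "n \<in> set (ms @ ns)" for n
    unfolding N_def using that by (intro member_le_sum_list) auto
  have "(\<Prod>q | Factorial_Ring.prime q \<and> q \<le> N. \<Prod>f = 1..N. (L (q ^ f) / L (q ^ (f - 1))) ^ prime_power_rank q f ms)
    \<le> (\<Prod>q | Factorial_Ring.prime q \<and> q \<le> N. \<Prod>f = 1..N. (L (q ^ f) / L (q ^ (f - 1))) ^ prime_power_rank q f ns)"
  proof (intro prod_mono conjI prod_nonneg)
    fix q f assume q: "q \<in> {q. Factorial_Ring.prime q \<and> q \<le> N}" and f: "f \<in> {1..N}"
    have "L (q ^ (f - 1)) > 0" using q by (intro pos) (simp add: Suc_le_eq prime_gt_0_nat)
    moreover have "L (q ^ (f - 1)) \<le> L (q ^ f)"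
      using mono[of q "f - 1"] q f by (cases f) auto
    ultimately have "1 \<le> L (q ^ f) / L (q ^ (f - 1))" by simp
    thus "(L (q ^ f) / L (q ^ (f - 1))) ^ prime_power_rank q f ms \<le> (L (q ^ f) / L (q ^ (f - 1))) ^ prime_power_rank q f ns"
      and "0 \<le> (L (q ^ f) / L (q ^ (f - 1))) ^ prime_power_rank q f ms"
      and "0 \<le> (L (q ^ f) / L (q ^ (f - 1))) ^ prime_power_rank q f ms"
      using ranks q f by (simp_all add: power_increasing)
  qed
  thus ?thesis
    using prod_list_increments[OF one mult pos, of ms N] prod_list_increments[OF one mult pos, of ns N] N ms ns
    by simp
qed

section \<open>Comparing the iterated unit groups\<close>

text \<open>As a function of the modulus, the torsion growth of the unit group satisfies the hypotheses of
\<open>prod_list_mono_prime_power_rank\<close>.\<close>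

lemma torsion_growth_units_mono:
  assumes ms: "\<forall>m\<in>set ms. m \<ge> 1" and ns: "\<forall>n\<in>set ns. n \<ge> 1"
    and ranks: "\<And>q f. Factorial_Ring.prime q \<Longrightarrow> f \<ge> 1 \<Longrightarrow> prime_power_rank q f ms \<le> prime_power_rank q f ns"
  shows "torsion_growth (units_of (Zn_ring_sum ms)) p e \<le> torsion_growth (units_of (Zn_ring_sum ns)) p e"
  unfolding torsion_growth_units_Zn_sum
proof (rule prod_list_mono_prime_power_rank[OF _ _ _ _ ms ns ranks])
  let ?L = "\<lambda>n. torsion_growth (units_of (Zn_ring n)) p e"
  have fin: "finite (carrier (units_of (Zn_ring n)))" if "n \<ge> 1" for n
    using that by (simp add: units_of_carrier Units_ZFact finite_subset[OF _ finite_carrier_ZFact, of _ "int n"] carrier_ZFact image_mono)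
  have "carrier (units_of (Zn_ring 1)) = {\<one>\<^bsub>units_of (Zn_ring 1)\<^esub>}"
    unfolding units_of_carrier units_of_one Units_ZFact one_ZFact of_nat_1
    using ZMod_one_trivial[of _ 1] coprime_1_left[of "1::int"] by blast
  thus "?L 1 = 1" by (intro torsion_growth_singleton group_units ring_Zn)
  show "?L (a * b) = ?L a * ?L b" if "coprime a b" for a b
    using that by (rule torsion_growth_units_Zn_coprime)
  show "?L n > 0" if "n \<ge> 1" for n
    using torsion_count_pos[OF group_units[OF ring_Zn] fin[OF that]] by (simp add: torsion_growth_def)
  show "?L (q ^ f) \<le> ?L (q ^ Suc f)" if q: "Factorial_Ring.prime q" for q f
  proof (rule torsion_growth_epi[OF comm_group_units_Zn comm_group_units_Zn _ units_residue_epi])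
    show "finite (carrier (units_of (Zn_ring (q ^ Suc f))))"
      using prime_gt_0_nat[OF q] by (intro fin) (simp add: Suc_le_eq)
  qed
qed

text \<open>That \<open>R\<close> is a ring is required separately because members of \<open>ring_iso\<close> need not map zero
to the element that \<open>R\<close> designates as its zero.\<close>

definition presents :: "nat list \<Rightarrow> 'a ring \<Rightarrow> bool"
  where "presents ns R \<longleftrightarrow> ring R \<and> (\<forall>n\<in>set ns. n \<ge> 1) \<and> (\<exists>h. h \<in> ring_iso (Zn_ring_sum ns) R)"

lemma presents_Zn: "n \<ge> 1 \<Longrightarrow> presents [n] (Zn_ring n)"
  using ring_iso_set_sym[OF ring_Zn RDirProd_list_iso3[of "Zn_ring n"]]
  by (auto simp: presents_def ring_Zn Zn_ring_sum_def)

text \<open>The moduli \<open>us\<close> of the chosen decomposition are accessible only through the ranks, and these are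
determined by the unit group of the previous stage.\<close>

lemma presents_units_ring:
  assumes "presents ns R"
  obtains us where "presents us (units_ring R)"
    "\<And>p e. Factorial_Ring.prime p \<Longrightarrow> torsion_growth (units_of (Zn_ring_sum ns)) p e = real p ^ prime_power_rank p (Suc e) us"
proof -
  obtain h where R: "ring R" and ns: "\<forall>n\<in>set ns. n \<ge> 1" and h: "h \<in> ring_iso (Zn_ring_sum ns) R"
    using assms by (auto simp: presents_def)
  have iso: "h \<in> iso (units_of (Zn_ring_sum ns)) (units_of R)"
    by (rule ring_iso_imp_units_iso[OF ring_Zn_sum h])
  have comm: "comm_group (units_of R)"
    using comm_group.iso_imp_comm_group[OF comm_group_units_Zn_sum] iso group_units[OF R]
    by (metis empty_iff group.is_monoid is_iso_def)
  have "bij_betw h (carrier (Zn_ring_sum ns)) (carrier R)" using h by (simp add: ring_iso_def)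
  hence "finite (carrier R)" using finite_Zn_sum[OF ns] by (simp add: bij_betw_finite)
  hence "finite (carrier (units_of R))"
    by (rule finite_subset[rotated]) (auto simp: units_of_carrier Units_def)
  then obtain d where "cyclic_decomposition (units_of R) d"
    using finite_comm_group_cyclic_decomposition[OF comm] by blast
  hence some: "cyclic_decomposition (units_of R) (SOME d. cyclic_decomposition (units_of R) d)"
    by (rule someI)
  obtain us f where d: "(SOME d. cyclic_decomposition (units_of R) d) = (us, f)"
    by (cases "SOME d. cyclic_decomposition (units_of R) d") auto
  have us: "\<forall>n\<in>set us. n \<ge> 1" and f: "f \<in> iso (add_monoid (Zn_ring_sum us)) (units_of R)"
    using some[unfolded d] unfolding cyclic_decomposition_def by blast+
  have units_ring: "units_ring R = image_ring f (Zn_ring_sum us)"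
    by (simp add: units_ring_def d)
  have inj: "inj_on f (carrier (Zn_ring_sum us))"
    using f by (simp add: iso_def bij_betw_def)
  have "presents us (units_ring R)"
    unfolding presents_def units_ring
    using us ring.inj_imp_image_ring_is_ring[OF ring_Zn_sum inj] inj_imp_image_ring_iso[OF inj] by blast
  moreover have "torsion_growth (units_of (Zn_ring_sum ns)) p e = real p ^ prime_power_rank p (Suc e) us"
    if p: "Factorial_Ring.prime p" for p e
    using torsion_growth_iso[OF group_units[OF ring_Zn_sum] group_units[OF R] iso]
      torsion_growth_iso[OF add_group[OF ring_Zn_sum] group_units[OF R] f]
      torsion_growth_add_Zn_sum[OF us p] by metis
  ultimately show thesis by (rule that)
qed

text \<open>Since \<open>m dvd n\<close>, the ranks of \<open>[m]\<close> are at most those of \<open>[n]\<close>, and every step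
preserves the comparison: ranks are the exponents of the torsion growth in the unit
group of the stage before.\<close>

lemma gen_units_prime_power_rank_le:
  assumes "m \<ge> 1" "n \<ge> 1" "m dvd n"
  shows "\<exists>ms ns. presents ms (gen_units k (Zn_ring m)) \<and> presents ns (gen_units k (Zn_ring n)) \<and>
    (\<forall>q f. Factorial_Ring.prime q \<longrightarrow> f \<ge> 1 \<longrightarrow> prime_power_rank q f ms \<le> prime_power_rank q f ns)"
proof (induction k)
  case 0
  have "prime_power_rank q f [m] \<le> prime_power_rank q f [n]" for q f
    using assms(3) by (auto simp: prime_power_rank_def)
  thus ?case using presents_Zn assms by (auto intro!: exI)
next
  case (Suc k)
  then obtain ms ns where ms: "presents ms (gen_units k (Zn_ring m))" and ns: "presents ns (gen_units k (Zn_ring n))"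
    and ranks: "\<And>q f. Factorial_Ring.prime q \<Longrightarrow> f \<ge> 1 \<Longrightarrow> prime_power_rank q f ms \<le> prime_power_rank q f ns"
    by blast
  obtain us where us: "presents us (gen_units (Suc k) (Zn_ring m))"
    and us_growth: "\<And>p e. Factorial_Ring.prime p \<Longrightarrow> torsion_growth (units_of (Zn_ring_sum ms)) p e = real p ^ prime_power_rank p (Suc e) us"
    using presents_units_ring[OF ms] by auto
  obtain vs where vs: "presents vs (gen_units (Suc k) (Zn_ring n))"
    and vs_growth: "\<And>p e. Factorial_Ring.prime p \<Longrightarrow> torsion_growth (units_of (Zn_ring_sum ns)) p e = real p ^ prime_power_rank p (Suc e) vs"
    using presents_units_ring[OF ns] by auto
  have "prime_power_rank p f us \<le> prime_power_rank p f vs" if p: "Factorial_Ring.prime p" and f: "f \<ge> 1" for p f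
  proof -
    obtain e where e: "f = Suc e" using f by (cases f) auto
    have "real p ^ prime_power_rank p f us \<le> real p ^ prime_power_rank p f vs"
      using torsion_growth_units_mono[OF _ _ ranks, where p = p and e = e] ms ns us_growth[OF p] vs_growth[OF p]
      by (simp add: presents_def e)
    thus ?thesis using prime_gt_1_nat[OF p] by simp
  qed
  with us vs show ?case by blast
qed

section \<open>Boolean rings among the direct sums\<close>

lemma boolean_ring_add_self:
  assumes "boolean_ring R" "x \<in> carrier R"
  shows "x \<oplus>\<^bsub>R\<^esub> x = \<zero>\<^bsub>R\<^esub>"
proof -
  interpret ring R using assms by (simp add: boolean_ring_def)
  have sq: "y \<otimes>\<^bsub>R\<^esub> y = y" if "y \<in> carrier R" for y
    using assms that by (simp add: boolean_ring_def)
  define y where "y = x \<oplus>\<^bsub>R\<^esub> x"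
  have y: "y \<in> carrier R" using assms(2) by (simp add: y_def)
  have "y = y \<otimes>\<^bsub>R\<^esub> (x \<oplus>\<^bsub>R\<^esub> x)" using sq[OF y] by (simp add: y_def)
  also have "\<dots> = y \<otimes>\<^bsub>R\<^esub> x \<oplus>\<^bsub>R\<^esub> y \<otimes>\<^bsub>R\<^esub> x" using y assms(2) by (simp add: r_distr)
  also have "y \<otimes>\<^bsub>R\<^esub> x = y" using assms(2) sq by (simp add: y_def l_distr)
  finally have "y \<oplus>\<^bsub>R\<^esub> y = y" ..
  thus ?thesis using y unfolding y_def[symmetric] by simp
qed

lemma prod_list_gcd_eq_imp_dvd:
  fixes ns :: "nat list"
  assumes "\<forall>n\<in>set ns. n \<ge> 1" "prod_list (map (gcd d) ns) = prod_list ns"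
  shows "\<forall>n\<in>set ns. n dvd d"
  using assms
proof (induction ns)
  case (Cons n ns)
  have le: "prod_list (map (gcd d) ns) \<le> prod_list ns" and pos: "prod_list ns > 0"
    using Cons.prems(1) by (induction ns) (auto intro!: mult_mono gcd_le2_nat)
  have n: "n > 0" using Cons.prems(1) by auto
  hence le_n: "gcd d n \<le> n" by simp
  have eq: "gcd d n * prod_list (map (gcd d) ns) = n * prod_list ns"
    using Cons.prems(2) by simp
  have "gcd d n = n"
  proof (rule ccontr)
    assume "gcd d n \<noteq> n"
    with le_n have "gcd d n < n" by simp
    hence "gcd d n * prod_list (map (gcd d) ns) < n * prod_list ns"
      using le pos by (meson le_less_trans mult_le_mono2 mult_less_mono1)
    with eq show False by simp
  qed
  moreover from this eq n have "prod_list (map (gcd d) ns) = prod_list ns" by simp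
  ultimately show ?case using Cons by (metis gcd_dvd1 list.set_intros(2) set_ConsD)
qed simp

text \<open>In a boolean ring all elements are killed by 2. Comparing the numbers of 2-torsion elements and of
all elements gives the product of the \<open>gcd 2 n\<close> on one side and the product of the \<open>n\<close> on the other.\<close>

lemma presents_boolean_ring_dvd_2:
  assumes bool: "boolean_ring R" and "presents ns R"
  shows "\<forall>n\<in>set ns. n dvd 2"
proof -
  obtain h where R: "ring R" and ns: "\<forall>n\<in>set ns. n \<ge> 1" and h: "h \<in> ring_iso (Zn_ring_sum ns) R"
    using assms by (auto simp: presents_def)
  have "x [^]\<^bsub>add_monoid R\<^esub> (2::nat) = \<one>\<^bsub>add_monoid R\<^esub>" if "x \<in> carrier (add_monoid R)" for x
    using that boolean_ring_add_self[OF bool, of x] ring.ring_simprules(8)[OF R, of x]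
    by (simp add: nat_pow_def numeral_2_eq_2)
  (* Every element is a solution for the exponent 0, so the count at 0 is the order of R. *)
  hence "torsion_count (add_monoid R) 2 = torsion_count (add_monoid R) 0"
    unfolding torsion_count_def by (intro arg_cong[of _ _ card] Collect_cong) (auto simp only: monoid.nat_pow_0[OF group.is_monoid[OF add_group[OF R]]])
  hence "prod_list (map (gcd 2) ns) = prod_list (map (gcd 0) ns)"
    unfolding torsion_count_iso[OF add_group[OF ring_Zn_sum] add_group[OF R] ring_iso_imp_add_iso[OF h]]
      torsion_count_add_Zn_sum[OF ns] .
  also have "map (gcd 0) ns = ns" by (simp add: map_idI)
  finally show ?thesis by (rule prod_list_gcd_eq_imp_dvd[OF ns])
qed

lemma trivial_ring_iso_Zn_1:
  assumes "ring R" "carrier R = {\<zero>\<^bsub>R\<^esub>}"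
  shows "R \<simeq> Zn_ring 1"
proof -
  have Z: "carrier (Zn_ring 1) = {\<zero>\<^bsub>Zn_ring 1\<^esub>}"
    using ring.ring_simprules(2)[OF ring_Zn, of 1] ZFact_one by simp
  interpret Z: ring "Zn_ring 1" by (rule ring_Zn)
  have eq_zero: "\<zero>\<^bsub>Zn_ring 1\<^esub> = u" if "u \<in> carrier (Zn_ring 1)" for u
    using that unfolding Z by simp
  have "(\<lambda>_. \<zero>\<^bsub>Zn_ring 1\<^esub>) \<in> ring_iso R (Zn_ring 1)"
  proof (rule ring_iso_memI)
    show "bij_betw (\<lambda>_. \<zero>\<^bsub>Zn_ring 1\<^esub>) (carrier R) (carrier (Zn_ring 1))"
      unfolding assms(2) Z by (simp add: bij_betw_def)
  qed (rule Z.zero_closed eq_zero Z.m_closed Z.a_closed Z.one_closed)+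
  thus ?thesis unfolding is_ring_iso_def by blast
qed

lemma presents_dvd_2_cases:
  assumes "presents ms R" "\<forall>m\<in>set ms. m dvd 2"
  shows "R \<simeq> Zn_ring 1 \<or> boolean_ring R"
proof (cases "carrier R = {\<zero>\<^bsub>R\<^esub>}")
  case True
  thus ?thesis using assms trivial_ring_iso_Zn_1 by (auto simp: presents_def)
next
  case False
  obtain h where R: "ring R" and h: "h \<in> ring_iso (Zn_ring_sum ms) R"
    using assms by (auto simp: presents_def)
  have "y \<otimes>\<^bsub>R\<^esub> y = y" if "y \<in> carrier R" for y
  proof -
    have "y \<in> h ` carrier (Zn_ring_sum ms)"
      using that bij_betw_imp_surj_on[OF ring_iso_memE(5)[OF h]] by simp
    then obtain x where "x \<in> carrier (Zn_ring_sum ms)" "y = h x"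
      by (elim imageE)
    thus ?thesis
      using ring_iso_memE(2)[OF h, of x x] Zn_sum_idempotent[OF assms(2), of x] by simp
  qed
  thus ?thesis using False R by (simp add: boolean_ring_def)
qed

text \<open>A prime power dividing an entry of \<open>ms\<close> has positive rank there, hence divides an entry of
\<open>ns\<close>, hence divides \<open>d\<close>.\<close>

lemma dvd_if_prime_power_rank_le:
  assumes ms: "\<forall>m\<in>set ms. m \<ge> 1" and ns: "\<forall>n\<in>set ns. n dvd d" and d: "d \<noteq> 0"
    and ranks: "\<forall>q f. Factorial_Ring.prime q \<longrightarrow> f \<ge> 1 \<longrightarrow> prime_power_rank q f ms \<le> prime_power_rank q f ns"
  shows "\<forall>m\<in>set ms. m dvd d"
proof
  fix m assume m: "m \<in> set ms"
  show "m dvd d"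
  proof (rule multiplicity_le_imp_dvd)
    show "m \<noteq> 0" using m ms by auto
    fix q :: nat assume q: "Factorial_Ring.prime q"
    define v where "v = multiplicity q m"
    have "q ^ v dvd d"
    proof (cases "v = 0")
      case False
      have "m \<in> set (filter (\<lambda>m. q ^ v dvd m) ms)" using m by (simp add: v_def multiplicity_dvd)
      hence "prime_power_rank q v ms > 0" unfolding prime_power_rank_def by (metis length_pos_if_in_set)
      also have "prime_power_rank q v ms \<le> prime_power_rank q v ns" using ranks q False by simp
      finally have "filter (\<lambda>n. q ^ v dvd n) ns \<noteq> []" by (simp add: prime_power_rank_def)
      then obtain n where "n \<in> set ns" "q ^ v dvd n" by (auto simp: filter_empty_conv)
      thus ?thesis using ns by (meson dvd_trans)
    qed simp
    thus "multiplicity q m \<le> multiplicity q d"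
      using d q by (metis not_prime_unit power_dvd_iff_le_multiplicity v_def)
  qed
qed

theorem theorem13:
  fixes k n m :: nat
  assumes "k \<ge> 1" and "n \<ge> 1"
    and "boolean_ring (gen_units k (Zn_ring n))"
    and "m dvd n"
  shows "gen_units k (Zn_ring m) \<simeq> Zn_ring 1 \<or> boolean_ring (gen_units k (Zn_ring m))"
proof -
  have "m \<ge> 1" using assms(2,4) by (cases m) auto
  then obtain ms ns where ms: "presents ms (gen_units k (Zn_ring m))" and ns: "presents ns (gen_units k (Zn_ring n))"
    and ranks: "\<forall>q f. Factorial_Ring.prime q \<longrightarrow> f \<ge> 1 \<longrightarrow> prime_power_rank q f ms \<le> prime_power_rank q f ns"
    using gen_units_prime_power_rank_le[OF _ assms(2,4)] by blast
  have "\<forall>n\<in>set ns. n dvd 2" by (rule presents_boolean_ring_dvd_2[OF assms(3) ns])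
  hence "\<forall>m\<in>set ms. m dvd 2"
    using ms by (intro dvd_if_prime_power_rank_le[OF _ _ _ ranks]) (simp_all add: presents_def)
  with ms show ?thesis by (rule presents_dvd_2_cases)
qed

end
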